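(* Assume that $\mathcal H_\Theta$ has a nonzero lower semi-continuous density with respect to the $(d-1)$-dimensional Hausdorff measure on $S^{d-1}$. Let $\lambda^\dagger=\sum_{i=1}^N m_i\delta_{(x_i,v_i)}\in\mathcal M_+(\Lambda)$ be a ground truth particle configuration and set $u_t^\dagger=\mathrm{Mv}^d_t\lambda^\dagger$, $\gamma_\theta^\dagger=\mathrm{Rj}_\theta\lambda^\dagger$, $f_t^\dagger=\mathrm{Ob}_tu_t^\dagger$. Assume there is a set $\emptyset\neq\mathcal T'\subset\mathcal T$ such that (1) for every $t\in\mathcal T'$ the measure $u_t^\dagger$ is the unique solution of $\min_{u\in\mathcal M_+(\Omega)}\|u\|_{\mathcal M}$ subject to $\mathrm{Ob}_tu=f_t^\dagger$; (2) $\lambda^\dagger$ has no coincidence at any time in $\mathcal T'$; (3) $\lambda^\dagger$ admits no ghost particle with respect to $\mathcal T'$. Then every solution $(u,\gamma)$ of $$\min_{\gamma\in\mathcal M_+(\Theta\times\Gamma),\ u\in\mathcal M_+(\Omega)^\Sigma}\|\gamma\|_{\mathcal M}\quad\text{s.t. }\ \mathrm{Ob}_tu_t=f_t^\dagger\ \ \forall t\in\mathcal T,\qquad \mathrm{Mv}^1_t\gamma_\theta=\mathrm{Rd}_\theta u_t\ \ \text{for all }t\in\Sigma\text{ and }\mathcal H_\Theta\text{-a.a. }\theta\in\Theta$$ satisfies $u_t=u_t^\dagger$ for all $t\in\Sigma$, and $\gamma_\theta=\gamma_\theta^\dagger$ for $\mathcal H_\Theta$-almost all $\theta\in\Theta$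.
   Context: $\mathcal M(X)$ and $\mathcal M_+(X)$ denote the finite signed and the finite nonnegative Radon measures on $X$, $\|\cdot\|_{\mathcal M}$ the total variation norm, $g_\#\nu$ the pushforward of $\nu$ under $g$. $d\in\mathbb N$; $\Omega\subset\mathbb R^d$, $\Sigma\subset\mathbb R$ and $\Theta\subset S^{d-1}$ are compact; $\emptyset\ne\mathcal T\subset\Sigma$ is finite; $\mathcal H_\Theta$ is a Borel probability measure on $\Theta$ with $\operatorname{supp}\mathcal H_\Theta=\Theta$. $\Lambda=\{(x,v)\in\mathbb R^d\times\mathbb R^d: x+tv\in\Omega\ \forall t\in\Sigma\}$ and $\Gamma=\{(\theta\cdot x,\theta\cdot v):(x,v)\in\Lambda,\theta\in\Theta\}\subset\mathbb R^2$; both are compact. Operators: $\mathrm{Rd}_\theta\nu=[x\mapsto\theta\cdot x]_\#\nu$ for $\nu\in\mathcal M(\mathbb R^d)$; $\mathrm{Rj}_\theta\lambda=[(x,v)\mapsto(\theta\cdot x,\theta\cdot v)]_\#\lambda$ for $\lambda\in\mathcal M(\mathbb R^d\times\mathbb R^d)$; $\mathrm{Mv}^n_t\lambda=[(x,v)\mapsto x+tv]_\#\lambda$ for $\lambda\in\mathcal M(\mathbb R^n\times\mathbb R^n)$. $H$ is a Hilbert space and, for $t\in\mathcal T$, $\mathrm{Ob}_t:\mathcal M(\Omega)\to H$ is the dual of a bounded linear operator $\mathrm{Ob}_t^*:H\to C(\Omega)$. In the minimization problem, the slices $\gamma_\theta\in\mathcal M_+(\Gamma)$ are defined by the disintegration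 $\gamma=\mathcal H_\Theta\otimes_\theta\gamma_\theta$, i.e. $\gamma(A\times B)=\int_A\gamma_\theta(B)\,\mathrm d\mathcal H_\Theta(\theta)$; the constraint includes the existence of this disintegration. $\mathcal M_+(\Omega)^\Sigma$ is the set of families $(u_t)_{t\in\Sigma}$ with $u_t\in\mathcal M_+(\Omega)$. $\lambda^\dagger$ has a coincidence at time $t$ if $x_i+tv_i=x_j+tv_j$ for two distinct particles $i\neq j$. $\lambda^\dagger$ admits a ghost particle with respect to $\mathcal T'$ if there is $(x,v)\in\mathbb R^d\times\mathbb R^d$ outside $\operatorname{supp}\lambda^\dagger$ such that for each $t\in\mathcal T'$ there is some $i$ (depending on $t$) with $x+tv=x_i+tv_i$. *)

theory Defs
  imports "HOL-Probability.Probability"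
begin

text \<open>
  The nonnegative measures on a subset \<open>X\<close> of a Euclidean space are represented by Borel measures on
  the ambient space that are concentrated on \<open>X\<close>. On these spaces every finite Borel measure is a
  Radon measure, so regularity is not a separate requirement. All measures that occur below are
  nonnegative; their total variation norm is therefore their total mass.
\<close>

definition meas_pos :: "'a::topological_space set \<Rightarrow> 'a measure set" where
  "meas_pos X = {M. sets M = sets borel \<and> finite_measure M \<and> (AE x in M. x \<in> X)}"

definition tv_norm :: "'a measure \<Rightarrow> real" where
  "tv_norm M = measure M (space M)"

definition supp :: "'a::topological_space measure \<Rightarrow> 'a set" where
  "supp M = {x. \<forall>U. open U \<and> x \<in> U \<longrightarrow> emeasure M U > 0}"


text \<open>
  Hausdorff measure of integer dimension \<open>k\<close>. The exponent is a natural number, so that \<open>0 ^ 0 = 1\<close>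
  and dimension \<open>0\<close> gives the counting measure; the empty set has to be excluded for this reason.
  Boundedness of the covering sets is required because \<open>diameter\<close> is meaningful only for bounded sets.
  The Borel sets are Caratheodory measurable for the metric outer measure \<open>hausdorff_outer k\<close>, so
  \<open>hausdorff_measure k\<close> takes the values of \<open>hausdorff_outer k\<close> on them.
\<close>

definition hausdorff_weight :: "nat \<Rightarrow> 'a::metric_space set \<Rightarrow> ennreal" where
  "hausdorff_weight k U =
     (if U = {} then 0 else ennreal (unit_ball_vol (real k) * (diameter U / 2) ^ k))"

definition hausdorff_pre :: "nat \<Rightarrow> real \<Rightarrow> 'a::metric_space set \<Rightarrow> ennreal" where
  "hausdorff_pre k \<delta> A =
     (INF U \<in> {U :: nat \<Rightarrow> 'a set. A \<subseteq> (\<Union>i. U i) \<and> (\<forall>i. bounded (U i) \<and> diameter (U i) \<le> \<delta>)}.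
        \<Sum>i. hausdorff_weight k (U i))"

definition hausdorff_outer :: "nat \<Rightarrow> 'a::metric_space set \<Rightarrow> ennreal" where
  "hausdorff_outer k A = (SUP \<delta> \<in> {0<..}. hausdorff_pre k \<delta> A)"

definition hausdorff_measure :: "nat \<Rightarrow> 'a::metric_space measure" where
  "hausdorff_measure k = measure_of UNIV (sets borel) (hausdorff_outer k)"

definition lsc_on :: "'a::topological_space set \<Rightarrow> ('a \<Rightarrow> 'b::linorder) \<Rightarrow> bool" where
  "lsc_on S f \<longleftrightarrow> (\<forall>a. openin (top_of_set S) {x \<in> S. a < f x})"

definition has_nonzero_lsc_density :: "(real^'d) measure \<Rightarrow> bool" where
  "has_nonzero_lsc_density H \<longleftrightarrow>
     (\<exists>\<rho> :: real^'d \<Rightarrow> ennreal.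
        lsc_on (sphere 0 1) \<rho> \<and> (\<exists>\<theta> \<in> sphere 0 1. \<rho> \<theta> \<noteq> 0) \<and>
        H = density (hausdorff_measure (CARD('d) - 1)) (\<lambda>\<theta>. \<rho> \<theta> * indicator (sphere 0 1) \<theta>))"


definition Lam :: "(real^'d) set \<Rightarrow> real set \<Rightarrow> ((real^'d) \<times> (real^'d)) set" where
  "Lam \<Omega> Sig = {(x, v). \<forall>t\<in>Sig. x + t *\<^sub>R v \<in> \<Omega>}"

definition Gam :: "(real^'d) set \<Rightarrow> real set \<Rightarrow> (real^'d) set \<Rightarrow> (real \<times> real) set" where
  "Gam \<Omega> Sig \<Theta> = {(\<theta> \<bullet> x, \<theta> \<bullet> v) | \<theta> x v. (x, v) \<in> Lam \<Omega> Sig \<and> \<theta> \<in> \<Theta>}"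

definition Rd :: "real^'d \<Rightarrow> (real^'d) measure \<Rightarrow> real measure" where
  "Rd \<theta> \<nu> = distr \<nu> borel (\<lambda>x. \<theta> \<bullet> x)"

definition Rj :: "real^'d \<Rightarrow> ((real^'d) \<times> (real^'d)) measure \<Rightarrow> (real \<times> real) measure" where
  "Rj \<theta> \<mu> = distr \<mu> borel (\<lambda>(x, v). (\<theta> \<bullet> x, \<theta> \<bullet> v))"

text \<open>The move operator in dimension \<open>n\<close>: \<open>'a\<close> is \<open>real^'d\<close> for \<open>n = d\<close> and \<open>real\<close> for \<open>n = 1\<close>.\<close>

definition Mv :: "real \<Rightarrow> ('a::euclidean_space \<times> 'a) measure \<Rightarrow> 'a measure" where
  "Mv t \<mu> = distr \<mu> borel (\<lambda>(x, v). x + t *\<^sub>R v)"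


text \<open>
  Bounded linear operators into \<open>C(\<Omega>)\<close>, whose elements are represented by functions on the ambient
  space with irrelevant values outside \<open>\<Omega>\<close>. For \<open>B\<close> of this kind, \<open>is_dual_of\<close> determines \<open>Ob\<close>
  uniquely on the nonnegative measures on \<open>\<Omega>\<close>, and thereby its linear extension to signed measures.
\<close>

definition bounded_linear_into_C ::
    "'a::topological_space set \<Rightarrow> ('h::real_normed_vector \<Rightarrow> 'a \<Rightarrow> real) \<Rightarrow> bool" where
  "bounded_linear_into_C \<Omega> B \<longleftrightarrow>
     (\<forall>g. continuous_on \<Omega> (B g)) \<and>
     (\<forall>g h. \<forall>x\<in>\<Omega>. B (g + h) x = B g x + B h x) \<and>
     (\<forall>c g. \<forall>x\<in>\<Omega>. B (c *\<^sub>R g) x = c * B g x) \<and>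
     (\<exists>K. \<forall>g. \<forall>x\<in>\<Omega>. \<bar>B g x\<bar> \<le> K * norm g)"

definition is_dual_of ::
    "'a::topological_space set \<Rightarrow> ('a measure \<Rightarrow> 'h::real_inner) \<Rightarrow> ('h \<Rightarrow> 'a \<Rightarrow> real) \<Rightarrow> bool" where
  "is_dual_of \<Omega> Ob B \<longleftrightarrow>
     (\<forall>\<nu> \<in> meas_pos \<Omega>. \<forall>g. Ob \<nu> \<bullet> g = (LINT x:\<Omega>|\<nu>. B g x))"


text \<open>The sum of the point masses \<open>m i\<close> at \<open>p i\<close> for \<open>i < N\<close>, as a pushforward of a measure on the indices.\<close>

definition particles :: "nat \<Rightarrow> (nat \<Rightarrow> real) \<Rightarrow> (nat \<Rightarrow> 'a::topological_space) \<Rightarrow> 'a measure" where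
  "particles N m p = distr (point_measure {..<N} (\<lambda>i. ennreal (m i))) borel p"

definition has_coincidence ::
    "nat \<Rightarrow> (nat \<Rightarrow> real^'d) \<Rightarrow> (nat \<Rightarrow> real^'d) \<Rightarrow> real \<Rightarrow> bool" where
  "has_coincidence N x v t \<longleftrightarrow> (\<exists>i<N. \<exists>j<N. i \<noteq> j \<and> x i + t *\<^sub>R v i = x j + t *\<^sub>R v j)"

definition has_ghost ::
    "nat \<Rightarrow> (nat \<Rightarrow> real) \<Rightarrow> (nat \<Rightarrow> real^'d) \<Rightarrow> (nat \<Rightarrow> real^'d) \<Rightarrow> real set \<Rightarrow> bool" where
  "has_ghost N m x v T' \<longleftrightarrow>
     (\<exists>y w. (y, w) \<notin> supp (particles N m (\<lambda>i. (x i, v i))) \<and>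
            (\<forall>t\<in>T'. \<exists>i<N. y + t *\<^sub>R w = x i + t *\<^sub>R v i))"


text \<open>The slices \<open>\<kappa> \<theta>\<close> of \<open>\<gamma>\<close> with respect to \<open>H\<close>; their values for \<open>\<theta>\<close> outside \<open>\<Theta>\<close> play no role.\<close>

definition disintegrates ::
    "'a::topological_space set \<Rightarrow> 'a measure \<Rightarrow> 'b::topological_space set \<Rightarrow>
     ('a \<times> 'b) measure \<Rightarrow> ('a \<Rightarrow> 'b measure) \<Rightarrow> bool" where
  "disintegrates \<Theta> H G \<gamma> \<kappa> \<longleftrightarrow>
     (\<forall>\<theta>\<in>\<Theta>. \<kappa> \<theta> \<in> meas_pos G) \<and>
     (\<forall>B \<in> sets borel. (\<lambda>\<theta>. emeasure (\<kappa> \<theta>) B) \<in> borel_measurable H) \<and>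
     (\<forall>A \<in> sets borel. \<forall>B \<in> sets borel.
        emeasure \<gamma> (A \<times> B) = (\<integral>\<^sup>+\<theta>\<in>A. emeasure (\<kappa> \<theta>) B \<partial>H))"

definition feasible ::
    "real set \<Rightarrow> real set \<Rightarrow> (real^'d) set \<Rightarrow> (real^'d) set \<Rightarrow> (real^'d) measure \<Rightarrow>
     (real \<Rightarrow> (real^'d) measure \<Rightarrow> 'h) \<Rightarrow> (real \<Rightarrow> 'h) \<Rightarrow>
     (real \<Rightarrow> (real^'d) measure) \<Rightarrow> ((real^'d) \<times> real \<times> real) measure \<Rightarrow> bool" where
  "feasible Sig T \<Omega> \<Theta> H Ob f u \<gamma> \<longleftrightarrow>
     \<gamma> \<in> meas_pos (\<Theta> \<times> Gam \<Omega> Sig \<Theta>) \<and>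
     (\<forall>t\<in>Sig. u t \<in> meas_pos \<Omega>) \<and>
     (\<forall>t\<in>T. Ob t (u t) = f t) \<and>
     (\<exists>\<kappa>. disintegrates \<Theta> H (Gam \<Omega> Sig \<Theta>) \<gamma> \<kappa> \<and>
          (\<forall>t\<in>Sig. AE \<theta> in H. Mv t (\<kappa> \<theta>) = Rd \<theta> (u t)))"

end

theory Submission
  imports Defs
begin

text \<open>
  The projected ground truth is feasible, so the solution has no larger mass; as the mass of \<open>\<gamma>\<close> equals
  that of every \<open>u t\<close>, the uniqueness assumption gives \<open>u t = u0 t\<close> for \<open>t \<in> T'\<close>. The only property
  of \<open>H\<close> that matters from then on is that it does not charge great spheres \<open>{\<theta>. \<theta> \<bullet> w = 0}\<close>.
  For almost every \<open>\<theta>\<close> the slice of \<open>\<gamma>\<close> is concentrated on projected lines that meet a projected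
  particle at each time in \<open>T'\<close>; since there are only finitely many candidates for these and no
  ghosts, they come from particles, and without coincidences the masses can be read off at a
  single time. This determines \<open>Rd \<theta> (u t)\<close> for every \<open>t\<close> and almost every \<open>\<theta>\<close>. Because \<open>u0 t\<close> is
  a finite sum of point masses, no injectivity theorem for the Radon transform is needed to
  conclude: by Fubini, a point off the support of \<open>u0 t\<close> would have to be projected into that of
  \<open>Rd \<theta> (u0 t)\<close> for almost every \<open>\<theta>\<close>.
\<close>

subsection \<open>Great spheres are null sets\<close>

text \<open>The balls of radius \<open>s\<close> about the points of \<open>Q\<close> are disjoint
  and lie in the ball of radius \<open>R + s\<close>; compare volumes.\<close>

lemma card_separated_le:
  fixes Q :: "'a::euclidean_space set"
  assumes "finite Q" and "Q \<subseteq> cball 0 R" and "0 \<le> R" and "0 < s"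
    and sep: "\<And>x y. x \<in> Q \<Longrightarrow> y \<in> Q \<Longrightarrow> x \<noteq> y \<Longrightarrow> 2 * s \<le> dist x y"
  shows "real (card Q) * s ^ DIM('a) \<le> (R + s) ^ DIM('a)"
proof -
  have "pairwise (\<lambda>x y. disjnt (ball x s) (ball y s)) Q"
  proof (rule pairwiseI)
    fix x y assume "x \<in> Q" "y \<in> Q" "x \<noteq> y"
    then have "2 * s \<le> dist x y" by (rule sep)
    then show "disjnt (ball x s) (ball y s)"
      unfolding disjnt_def by (intro disjoint_ballI) auto
  qed
  then have "measure lborel (\<Union>x\<in>Q. ball x s) = (\<Sum>x\<in>Q. measure lborel (ball x s))"
    using \<open>finite Q\<close> by (intro measure_UNION') (auto intro!: fmeasurableI emeasure_bounded_finite)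
  also have "\<dots> = unit_ball_vol (DIM('a)) * (real (card Q) * s ^ DIM('a))"
    using \<open>0 < s\<close> by (simp add: content_ball)
  finally have "unit_ball_vol (DIM('a)) * (real (card Q) * s ^ DIM('a)) = measure lborel (\<Union>x\<in>Q. ball x s)" ..
  also have "\<dots> \<le> measure lborel (cball (0::'a) (R + s))"
  proof (rule measure_mono_fmeasurable)
    show "(\<Union>x\<in>Q. ball x s) \<subseteq> cball 0 (R + s)"
    proof safe
      fix x y assume "x \<in> Q" "y \<in> ball x s"
      then have "norm x \<le> R" "dist x y < s" using \<open>Q \<subseteq> cball 0 R\<close> by auto
      then show "y \<in> cball 0 (R + s)"
        using dist_triangle[of 0 y x] by (simp add: dist_commute)
    qed
  qed (use \<open>finite Q\<close> in \<open>auto intro!: fmeasurableI emeasure_bounded_finite sets.finite_UN\<close>)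
  also have "\<dots> = unit_ball_vol (DIM('a)) * (R + s) ^ DIM('a)"
    using assms by (simp add: content_cball)
  finally show ?thesis by simp
qed

text \<open>For unit vectors the squared right-hand side is \<open>(a - b)^2\<close> plus
  \<open>a * b\<close> times the squared left-hand side, and \<open>a * b \<ge> 1\<close>. Pushing
  points of the sphere outwards thus preserves their separation.\<close>

lemma norm_diff_le_scaled:
  fixes p q :: "'a::real_inner"
  assumes "norm p = 1" "norm q = 1" "1 \<le> a" "1 \<le> b"
  shows "norm (p - q) \<le> norm (a *\<^sub>R p - b *\<^sub>R q)"
proof -
  have pq: "p \<bullet> q \<le> 1" using norm_cauchy_schwarz[of p q] assms by simp
  have "(norm (p - q))\<^sup>2 = 2 - 2 * (p \<bullet> q)"
    using assms by (simp add: power2_norm_eq_inner inner_diff_left inner_diff_right inner_commute norm_eq_1)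
  also have "\<dots> \<le> a * b * (2 - 2 * (p \<bullet> q))"
    using mult_mono[of 1 "a*b" "2 - 2 * (p \<bullet> q)" "2 - 2 * (p \<bullet> q)"] pq assms
      mult_mono[of 1 a 1 b] by simp
  also have "\<dots> \<le> (a - b)\<^sup>2 + a * b * (2 - 2 * (p \<bullet> q))" by simp
  also have "\<dots> = (norm (a *\<^sub>R p - b *\<^sub>R q))\<^sup>2"
    using assms by (simp add: power2_norm_eq_inner inner_diff_left inner_diff_right inner_commute norm_eq_1)
      (simp add: power2_eq_square algebra_simps)
  finally show ?thesis by (rule power2_le_imp_le) simp
qed

text \<open>Scaling by \<open>1 + k/n\<close> and translating by \<open>(l/n) w\<close> turns a \<open>1/n\<close>-separated subset of the great
  sphere orthogonal to \<open>w\<close> into an \<open>n\<^sup>2\<close> times larger one of a fixed ball. This gives the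
  codimension two.\<close>

lemma card_separated_great_sphere_le:
  fixes w :: "'a::euclidean_space"
  assumes "finite P" and P: "P \<subseteq> sphere 0 1 \<inter> {p. p \<bullet> w = 0}" and w: "norm w = 1" and "0 < n"
    and sep: "\<And>p q. p \<in> P \<Longrightarrow> q \<in> P \<Longrightarrow> p \<noteq> q \<Longrightarrow> 1 / real n \<le> dist p q"
  shows "real (card P) * (real n)\<^sup>2 \<le> (8 * real n) ^ DIM('a)"
proof -
  define F where "F = (\<lambda>(p, k, l). (1 + real k / n) *\<^sub>R p + (real l / n) *\<^sub>R w)"
  let ?I = "P \<times> {..<n} \<times> {..<n}"
  have n: "real n \<ge> 1" using \<open>0 < n\<close> by simp
  have nat_sep: "1 / real n \<le> \<bar>real a / n - real b / n\<bar>" if "a \<noteq> b" for a b :: nat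
  proof -
    have "1 \<le> \<bar>real a - real b\<bar>" using that by linarith
    then show ?thesis using n by (simp add: field_simps flip: diff_divide_distrib)
  qed
  have far: "1 / real n \<le> dist (F i) (F j)" if "i \<in> ?I" "j \<in> ?I" "i \<noteq> j" for i j
  proof -
    obtain p k l where i: "i = (p, k, l)" by (cases i) auto
    obtain q k' l' where j: "j = (q, k', l')" by (cases j) auto
    have p: "norm p = 1" "p \<bullet> w = 0" "p \<in> P" and q: "norm q = 1" "q \<bullet> w = 0" "q \<in> P"
      using that P by (auto simp: i j)
    define y where "y = (1 + real k / n) *\<^sub>R p - (1 + real k' / n) *\<^sub>R q"
    define c where "c = real l / n - real l' / n"
    \<comment> \<open>As \<open>y\<close> is orthogonal to \<open>w\<close>, Pythagoras splits the
      distance into the part \<open>y\<close>, which sees \<open>p\<close> and \<open>k\<close>, and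
      the part \<open>c\<close>, which sees \<open>l\<close>. Whichever index differs, one of the
      two parts is at least \<open>1 / n\<close>.\<close>
    have "y \<bullet> w = 0" by (simp add: y_def inner_diff_left p q)
    moreover have "F i - F j = y + c *\<^sub>R w"
      by (simp add: F_def i j y_def c_def algebra_simps)
    ultimately have eq: "(dist (F i) (F j))\<^sup>2 = (norm y)\<^sup>2 + c\<^sup>2"
      using w by (simp add: dist_norm power2_norm_eq_inner inner_add_left inner_add_right
          inner_commute norm_eq_1) (simp add: power2_eq_square)
    consider "p \<noteq> q" | "p = q" "k \<noteq> k'" | "l \<noteq> l'" using \<open>i \<noteq> j\<close> unfolding i j by blast
    then have "(1 / real n)\<^sup>2 \<le> (norm y)\<^sup>2 + c\<^sup>2"
    proof cases
      case 1
      have "1 / real n \<le> norm (p - q)" using sep[of p q] 1 p q by (simp add: dist_norm)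
      also have "\<dots> \<le> norm y" unfolding y_def by (rule norm_diff_le_scaled) (use p q in auto)
      finally have "(1 / real n)\<^sup>2 \<le> (norm y)\<^sup>2" by (intro power_mono) auto
      then show ?thesis by (simp add: add_increasing2)
    next
      case 2
      have "y = (real k / n - real k' / n) *\<^sub>R p" by (simp add: y_def 2 algebra_simps)
      then have "norm y = \<bar>real k / n - real k' / n\<bar>" using p by simp
      then have "(1 / real n)\<^sup>2 \<le> (norm y)\<^sup>2" using nat_sep[of k k'] 2 by (intro power_mono) auto
      then show ?thesis by (simp add: add_increasing2)
    next
      case 3
      have "(1 / real n)\<^sup>2 \<le> \<bar>c\<bar>\<^sup>2" unfolding c_def using nat_sep[of l l'] 3 by (intro power_mono) auto
      then show ?thesis by (simp add: add_increasing)
    qed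
    then show ?thesis unfolding eq[symmetric] by (rule power2_le_imp_le) simp
  qed
  have inj: "inj_on F ?I"
  proof (rule inj_onI, rule ccontr)
    fix i j assume "i \<in> ?I" "j \<in> ?I" "F i = F j" "i \<noteq> j"
    then show False using far[of i j] n by simp
  qed
  have "F ` ?I \<subseteq> cball 0 3"
  proof (rule image_subsetI)
    fix i assume "i \<in> ?I"
    then obtain p k l where i: "i = (p, k, l)" "p \<in> P" "k < n" "l < n" by auto
    have "norm p = 1" using P i by auto
    then have "norm (F i) \<le> \<bar>1 + real k / n\<bar> + \<bar>real l / n\<bar>"
      using norm_triangle_ineq[of "(1 + real k / n) *\<^sub>R p" "(real l / n) *\<^sub>R w"] w by (simp add: F_def i)
    also have "\<dots> \<le> 3" using i by (simp add: field_simps)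
    finally show "F i \<in> cball 0 3" by simp
  qed
  \<comment> \<open>Volume comparison with half the separation, \<open>s = 1 / (2 * n)\<close>, as
    the radius. The right-hand side is bounded by \<open>4 ^ DIM('a)\<close>, and clearing
    \<open>s\<close> contributes a factor \<open>2 * n\<close> per dimension.\<close>
  then have "real (card (F ` ?I)) * (1 / (2 * real n)) ^ DIM('a) \<le> (3 + 1 / (2 * real n)) ^ DIM('a)"
  proof (intro card_separated_le)
    fix a b assume "a \<in> F ` ?I" "b \<in> F ` ?I" "a \<noteq> b"
    then obtain i j where "i \<in> ?I" "j \<in> ?I" "a = F i" "b = F j" "i \<noteq> j" by blast
    then show "2 * (1 / (2 * real n)) \<le> dist a b" using far[of i j] by simp
  qed (use \<open>finite P\<close> n in auto)
  also have "\<dots> \<le> 4 ^ DIM('a)" using n by (intro power_mono) (auto simp: field_simps)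
  finally have "real (card P) * (real n)\<^sup>2 * (1 / (2 * real n)) ^ DIM('a) \<le> 4 ^ DIM('a)"
    using inj by (simp add: card_image card_cartesian_product power2_eq_square)
  then have "real (card P) * (real n)\<^sup>2 \<le> 4 ^ DIM('a) * (2 * real n) ^ DIM('a)"
    using n by (simp add: power_one_over field_simps)
  also have "\<dots> = (8 * real n) ^ DIM('a)"
    unfolding power_mult_distrib[symmetric] by simp
  finally show ?thesis .
qed

text \<open>Take a \<open>1 / n\<close>-separated subset of largest cardinality. A point missed by
  its balls could be added to it.\<close>

lemma great_sphere_cover:
  fixes w :: "'a::euclidean_space"
  assumes w: "norm w = 1" and "0 < n"
  obtains P where "finite P" and "sphere 0 1 \<inter> {p. p \<bullet> w = 0} \<subseteq> (\<Union>p\<in>P. cball p (1 / real n))"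
    and "real (card P) * (real n)\<^sup>2 \<le> (8 * real n) ^ DIM('a)"
proof -
  let ?S = "sphere 0 1 \<inter> {p. p \<bullet> w = 0}"
  define Sep where "Sep P \<longleftrightarrow> finite P \<and> P \<subseteq> ?S \<and>
      (\<forall>p\<in>P. \<forall>q\<in>P. p \<noteq> q \<longrightarrow> 1 / real n \<le> dist p q)" for P
  have bound: "real (card P) * (real n)\<^sup>2 \<le> (8 * real n) ^ DIM('a)" if "Sep P" for P
    using that by (intro card_separated_great_sphere_le[OF _ _ w \<open>0 < n\<close>]) (auto simp: Sep_def)
  \<comment> \<open>A crude bound, which serves only to make a largest separated set exist.\<close>
  have "card P \<le> nat \<lceil>(8 * real n) ^ DIM('a)\<rceil>" if "Sep P" for P
  proof -
    have "real (card P) * 1 \<le> real (card P) * (real n)\<^sup>2"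
      using \<open>0 < n\<close> by (intro mult_left_mono) auto
    then show ?thesis using bound[OF that] by linarith
  qed
  moreover have "Sep {}" by (simp add: Sep_def)
  ultimately obtain P where P: "Sep P" and max: "\<And>P'. Sep P' \<Longrightarrow> card P' \<le> card P"
    using ex_has_greatest_nat[of Sep "{}" card "Suc (nat \<lceil>(8 * real n) ^ DIM('a)\<rceil>)"]
    by (auto simp: less_Suc_eq_le)
  have "?S \<subseteq> (\<Union>p\<in>P. cball p (1 / real n))"
  proof (rule ccontr)
    assume "\<not> ?thesis"
    then obtain q where q: "q \<in> ?S" "\<And>p. p \<in> P \<Longrightarrow> 1 / real n < dist p q" by (force simp: not_le)
    then have "Sep (insert q P)" using P by (auto simp: Sep_def dist_commute less_imp_le)
    moreover have "q \<notin> P" using q(2)[of q] by auto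
    moreover have "finite P" using P by (simp add: Sep_def)
    ultimately show False using max[of "insert q P"] by simp
  qed
  with that[OF _ this bound[OF P]] P show ?thesis by (simp add: Sep_def)
qed

lemma hausdorff_outer_eq_0I:
  fixes A :: "'a::metric_space set"
  assumes "\<And>\<delta> \<epsilon>. 0 < \<delta> \<Longrightarrow> 0 < \<epsilon> \<Longrightarrow> \<exists>U. A \<subseteq> (\<Union>i. U i) \<and>
    (\<forall>i. bounded (U i) \<and> diameter (U i) \<le> \<delta>) \<and> (\<Sum>i. hausdorff_weight k (U i)) \<le> ennreal \<epsilon>"
  shows "hausdorff_outer k A = 0"
proof -
  have "hausdorff_pre k \<delta> A = 0" if "0 < \<delta>" for \<delta>
  proof -
    have le: "hausdorff_pre k \<delta> A \<le> 0 + ennreal \<epsilon>" if "0 < \<epsilon>" for \<epsilon>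
    proof -
      obtain U where "A \<subseteq> (\<Union>i. U i)" "\<forall>i. bounded (U i) \<and> diameter (U i) \<le> \<delta>"
        "(\<Sum>i. hausdorff_weight k (U i)) \<le> ennreal \<epsilon>"
        using assms[OF \<open>0 < \<delta>\<close> \<open>0 < \<epsilon>\<close>] by blast
      then show ?thesis unfolding hausdorff_pre_def by (intro INF_lower2[of U]) auto
    qed
    have "hausdorff_pre k \<delta> A \<le> 0" by (rule ennreal_le_epsilon) (rule le)
    then show ?thesis by simp
  qed
  then show ?thesis by (auto simp: hausdorff_outer_def)
qed

text \<open>With \<open>d = DIM('a)\<close>, at most \<open>8^d * n^(d-2)\<close> balls of radius
  \<open>1 / n\<close> cover the great sphere, each of weight proportional to
  \<open>n^-(d-1)\<close>. The total is at most \<open>C / n\<close>. This includes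
  \<open>d = 1\<close>, where no ball is left for large \<open>n\<close>.\<close>

lemma hausdorff_outer_great_sphere:
  fixes w :: "'a::euclidean_space"
  assumes "w \<noteq> 0"
  shows "hausdorff_outer (DIM('a) - 1) (sphere 0 1 \<inter> {p. p \<bullet> w = 0}) = 0"
proof -
  define w' where "w' = w /\<^sub>R norm w"
  have w': "norm w' = 1" using assms by (simp add: w'_def)
  have S: "sphere 0 1 \<inter> {p. p \<bullet> w = 0} = sphere 0 1 \<inter> {p. p \<bullet> w' = 0}"
    using assms by (auto simp: w'_def)
  define k where "k = DIM('a) - 1"
  have k: "DIM('a) = Suc k" using DIM_positive[where 'a='a] by (simp add: k_def)
  define C where "C = unit_ball_vol k * 8 ^ DIM('a)"
  have "0 \<le> C" by (simp add: C_def)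
  show ?thesis unfolding S
  proof (rule hausdorff_outer_eq_0I)
    fix \<delta> \<epsilon> :: real assume "0 < \<delta>" "0 < \<epsilon>"
    \<comment> \<open>The first summand makes the diameters \<open>2 / n\<close> at most
      \<open>\<delta>\<close>, the second makes the total weight \<open>C / n\<close> at most
      \<open>\<epsilon>\<close>.\<close>
    obtain n where n: "2 / \<delta> + C / \<epsilon> < real n" using reals_Archimedean2 by blast
    have "0 < 2 / \<delta>" "0 \<le> C / \<epsilon>" using \<open>0 < \<delta>\<close> \<open>0 < \<epsilon>\<close> \<open>0 \<le> C\<close> by auto
    then have "0 < n" and n1: "2 / \<delta> \<le> real n" and n2: "C / \<epsilon> \<le> real n" using n by linarith+
    obtain P where P: "finite P" "sphere 0 1 \<inter> {p. p \<bullet> w' = 0} \<subseteq> (\<Union>p\<in>P. cball p (1 / real n))"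
      and card: "real (card P) * (real n)\<^sup>2 \<le> (8 * real n) ^ DIM('a)"
      using great_sphere_cover[OF w' \<open>0 < n\<close>] .
    obtain e where e: "bij_betw e {..<card P} P"
      using ex_bij_betw_nat_finite[OF P(1)] by (auto simp: atLeast0LessThan)
    \<comment> \<open>The finite cover is padded to a sequence with empty sets, whose weight is 0 in
      every dimension, including dimension 0.\<close>
    define U where "U i = (if i < card P then cball (e i) (1 / real n) else {})" for i
    have wt: "hausdorff_weight k (U i) = (if i < card P then ennreal (unit_ball_vol k * (1 / real n) ^ k) else 0)" for i
      using \<open>0 < n\<close> by (simp add: U_def hausdorff_weight_def)
    have "(\<Sum>i. hausdorff_weight k (U i)) = (\<Sum>i<card P. hausdorff_weight k (U i))"
      by (rule suminf_finite) (auto simp: wt)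
    also have "\<dots> = ennreal (real (card P) * (unit_ball_vol k * (1 / real n) ^ k))"
      by (simp add: wt ennreal_mult ennreal_of_nat_eq_real_of_nat)
    also have "\<dots> \<le> ennreal \<epsilon>"
    proof (rule ennreal_leI)
      have "real (card P) \<le> (8 * real n) ^ DIM('a) / (real n)\<^sup>2"
        using card \<open>0 < n\<close> by (simp add: field_simps)
      then have "real (card P) * (unit_ball_vol k * (1 / real n) ^ k)
          \<le> (8 * real n) ^ DIM('a) / (real n)\<^sup>2 * (unit_ball_vol k * (1 / real n) ^ k)"
        by (rule mult_right_mono) simp
      also have "\<dots> = C / real n"
        using \<open>0 < n\<close> by (simp add: C_def k power_mult_distrib power_one_over power2_eq_square field_simps)
      also have "\<dots> \<le> \<epsilon>" using n2 \<open>0 < n\<close> \<open>0 < \<epsilon>\<close> by (simp add: field_simps)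
      finally show "real (card P) * (unit_ball_vol k * (1 / real n) ^ k) \<le> \<epsilon>" .
    qed
    finally have sum: "(\<Sum>i. hausdorff_weight k (U i)) \<le> ennreal \<epsilon>" .
    have "sphere 0 1 \<inter> {p. p \<bullet> w' = 0} \<subseteq> (\<Union>i. U i)"
    proof
      fix y assume "y \<in> sphere 0 1 \<inter> {p. p \<bullet> w' = 0}"
      then obtain p where "p \<in> P" "y \<in> cball p (1 / real n)" using P by blast
      moreover then obtain i where "i < card P" "p = e i" using e by (auto simp: bij_betw_def)
      ultimately show "y \<in> (\<Union>i. U i)" by (auto simp: U_def)
    qed
    moreover have "\<forall>i. bounded (U i) \<and> diameter (U i) \<le> \<delta>"
      using n1 \<open>0 < n\<close> \<open>0 < \<delta>\<close> by (auto simp: U_def field_simps)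
    ultimately show "\<exists>U. sphere 0 1 \<inter> {p. p \<bullet> w' = 0} \<subseteq> (\<Union>i. U i) \<and>
        (\<forall>i. bounded (U i) \<and> diameter (U i) \<le> \<delta>) \<and>
        (\<Sum>i. hausdorff_weight (DIM('a) - 1) (U i)) \<le> ennreal \<epsilon>"
      using sum unfolding k_def by blast
  qed
qed

lemma sets_hausdorff_measure [simp]:
  "sets (hausdorff_measure k :: 'a::metric_space measure) = sets borel"
  unfolding hausdorff_measure_def using sets.sigma_sets_eq[of borel] by (simp add: sets_measure_of_conv)

text \<open>A measure built by \<open>measure_of\<close> takes either the prescribed value or 0. The
  upper bound holds in both cases and is all that null sets require.\<close>

lemma emeasure_hausdorff_measure_le: "emeasure (hausdorff_measure k) A \<le> hausdorff_outer k A"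
  by (simp add: hausdorff_measure_def emeasure_measure_of_conv)

lemma lsc_on_imp_borel_measurable:
  fixes f :: "'a::topological_space \<Rightarrow> ennreal"
  assumes "lsc_on S f" and "S \<in> sets borel"
  shows "(\<lambda>x. f x * indicator S x) \<in> borel_measurable borel"
proof (rule borel_measurableI_greater)
  fix a :: ennreal
  obtain U where "open U" and U: "{x \<in> S. a < f x} = S \<inter> U"
    using assms(1) unfolding lsc_on_def openin_open by metis
  \<comment> \<open>Outside \<open>S\<close> the product is 0, which exceeds no \<open>a\<close> in
    \<open>ennreal\<close>.\<close>
  have "{x \<in> space borel. a < f x * indicator S x} = S \<inter> U"
    unfolding U[symmetric] by (auto simp: indicator_def split: if_splits)
  then show "{x \<in> space borel. a < f x * indicator S x} \<in> sets borel"
    using assms(2) \<open>open U\<close> by auto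
qed

text \<open>The density vanishes off the sphere, and the exceptional directions on the sphere form a
  great sphere, which is null for the Hausdorff measure.\<close>

lemma AE_inner_nonzero:
  fixes H :: "(real^'d) measure"
  assumes "has_nonzero_lsc_density H" and "w \<noteq> 0"
  shows "AE \<theta> in H. \<theta> \<bullet> w \<noteq> 0"
proof -
  let ?S = "sphere 0 1 :: (real^'d) set"
  let ?M = "hausdorff_measure (CARD('d) - 1) :: (real^'d) measure"
  obtain \<rho> :: "real^'d \<Rightarrow> ennreal" where \<rho>: "lsc_on ?S \<rho>"
    and H: "H = density ?M (\<lambda>\<theta>. \<rho> \<theta> * indicator ?S \<theta>)"
    using assms(1) unfolding has_nonzero_lsc_density_def by blast
  have meas: "(\<lambda>\<theta>. \<rho> \<theta> * indicator ?S \<theta>) \<in> borel_measurable ?M"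
    using lsc_on_imp_borel_measurable[OF \<rho>] measurable_cong_sets[OF sets_hausdorff_measure refl]
    by (auto simp: borel_closed)
  let ?Z = "?S \<inter> {p. p \<bullet> w = 0}"
  have "closed {p. p \<bullet> w = 0}" by (intro closed_Collect_eq continuous_intros)
  then have "?Z \<in> sets borel" by (intro borel_closed closed_Int) auto
  moreover have "emeasure ?M ?Z = 0"
    using emeasure_hausdorff_measure_le[of "CARD('d) - 1" ?Z] hausdorff_outer_great_sphere[OF assms(2)]
    by simp
  ultimately have "?Z \<in> null_sets ?M" by auto
  then have "AE \<theta> in ?M. \<theta> \<notin> ?Z" by (rule AE_not_in)
  then show ?thesis unfolding H AE_density[OF meas]
    by eventually_elim (auto simp: indicator_def split: if_splits)
qed

subsection \<open>Finite sums of point masses\<close>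

lemma meas_posD:
  assumes "M \<in> meas_pos X"
  shows "sets M = sets borel" "finite_measure M" "AE x in M. x \<in> X"
  using assms by (auto simp: meas_pos_def)

lemma sets_particles [simp]: "sets (particles N m p) = sets borel"
  by (simp add: particles_def)

lemma space_particles [simp]: "space (particles N m p) = UNIV"
  by (simp add: particles_def)

lemma emeasure_particles:
  assumes "B \<in> sets borel"
  shows "emeasure (particles N m p) B = (\<Sum>i<N. ennreal (m i) * indicator B (p i))"
proof -
  have "emeasure (particles N m p) B = emeasure (point_measure {..<N} (\<lambda>i. ennreal (m i))) (p -` B \<inter> {..<N})"
    using assms by (simp add: particles_def emeasure_distr space_point_measure)
  also have "\<dots> = (\<Sum>i\<in>p -` B \<inter> {..<N}. ennreal (m i))"
    by (rule emeasure_point_measure_finite) auto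
  also have "\<dots> = (\<Sum>i<N. ennreal (m i) * indicator B (p i))"
    by (intro sum.mono_neutral_cong_left) (auto simp: indicator_def)
  finally show ?thesis .
qed

lemma finite_measure_particles [simp]: "finite_measure (particles N m p)"
  by (rule finite_measureI) (simp add: emeasure_particles ennreal_mult_eq_top_iff)

lemma distr_particles:
  assumes "g \<in> borel_measurable borel"
  shows "distr (particles N m p) borel g = particles N m (\<lambda>i. g (p i))"
  unfolding particles_def using assms by (subst distr_distr) (auto simp: comp_def)

lemma AE_particles:
  assumes "{z. P z} \<in> sets borel"
  shows "(AE z in particles N m p. P z) \<longleftrightarrow> (\<forall>i<N. 0 < m i \<longrightarrow> P (p i))"
  unfolding particles_def using assms by (subst AE_distr_iff) (auto simp: AE_point_measure)

text \<open>In contrast to the equivalence in \<open>AE_particles\<close>, this direction is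
  available for any predicate \<open>P\<close>. It locates the particles of positive mass in
  \<open>Lam \<Omega> Sig\<close>.\<close>

lemma AE_particles_imp:
  assumes "AE z in particles N m p. P z" "i < N" "0 < m i"
  shows "P (p i)"
  using AE_distrD[OF _ assms(1)[unfolded particles_def]] assms(2,3) by (auto simp: AE_point_measure)

lemma AE_particles_support:
  fixes p :: "nat \<Rightarrow> 'a::t1_space"
  shows "AE z in particles N m p. z \<in> p ` {..<N}"
  by (subst AE_particles) (auto intro: borel_closed finite_imp_closed)

lemma supp_particles:
  fixes p :: "nat \<Rightarrow> 'a::t1_space"
  shows "supp (particles N m p) \<subseteq> p ` {..<N}"
proof
  fix z assume z: "z \<in> supp (particles N m p)"
  show "z \<in> p ` {..<N}"
  proof (rule ccontr)
    assume "z \<notin> p ` {..<N}"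
    moreover have "open (- p ` {..<N})" by (simp add: finite_imp_closed open_Compl)
    ultimately have "0 < emeasure (particles N m p) (- p ` {..<N})"
      using z by (simp add: supp_def)
    then show False by (simp add: emeasure_particles finite_imp_closed open_Compl)
  qed
qed

lemma measurable_fst_add_scaleR [measurable]:
  "(\<lambda>(x, v). x + t *\<^sub>R v :: 'a::euclidean_space) \<in> borel_measurable borel"
  unfolding case_prod_beta by (intro borel_measurable_continuous_onI continuous_intros)

lemma measurable_inner_pair [measurable]:
  "(\<lambda>(x, v). (\<theta> \<bullet> x, \<theta> \<bullet> v)) \<in> borel_measurable (borel :: ('a::euclidean_space \<times> 'a) measure)"
  unfolding case_prod_beta by (intro borel_measurable_continuous_onI continuous_intros)

lemma Mv_particles: "Mv t (particles N m p) = particles N m (\<lambda>i. fst (p i) + t *\<^sub>R snd (p i))"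
  unfolding Mv_def by (simp add: distr_particles case_prod_beta)

lemma Rd_particles: "Rd \<theta> (particles N m p) = particles N m (\<lambda>i. \<theta> \<bullet> p i)"
  unfolding Rd_def by (simp add: distr_particles)

lemma Rj_particles: "Rj \<theta> (particles N m p) = particles N m (\<lambda>i. (\<theta> \<bullet> fst (p i), \<theta> \<bullet> snd (p i)))"
  unfolding Rj_def by (simp add: distr_particles case_prod_beta)

text \<open>On the finite carrier, the injective map \<open>g\<close> identifies each position with
  its image, so the masses of \<open>M\<close> can be read off from the pushforward.\<close>

lemma eq_particlesI:
  fixes p :: "nat \<Rightarrow> 'a::t1_space" and g :: "'a \<Rightarrow> 'b::t1_space"
  assumes M: "sets M = sets borel" and g: "g \<in> borel_measurable borel"
    and supp: "AE z in M. z \<in> p ` {..<N}"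
    and distr: "distr M borel g = particles N m (\<lambda>i. g (p i))"
    and inj: "inj_on g (p ` {..<N})"
  shows "M = particles N m p"
proof (rule measure_eqI)
  have gM: "g \<in> measurable M borel" using M g by (simp cong: measurable_cong_sets)
  have space: "space M = UNIV" using sets_eq_imp_space_eq[OF M] by simp
  fix A assume "A \<in> sets M"
  then have A: "A \<in> sets borel" using M by simp
  \<comment> \<open>Intersecting with the positions makes the image finite, hence Borel, although
    the image of \<open>A\<close> itself may fail to be Borel.\<close>
  let ?F = "g ` (A \<inter> p ` {..<N})"
  have F: "?F \<in> sets borel" by (intro borel_closed finite_imp_closed) auto
  have in_F: "g z \<in> ?F \<longleftrightarrow> z \<in> A" if "z \<in> p ` {..<N}" for z
    using that inj by (auto dest: inj_onD)
  have "AE z in M. z \<in> A \<longleftrightarrow> z \<in> g -` ?F \<inter> space M"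
    using supp by eventually_elim (use in_F space in auto)
  then have "emeasure M A = emeasure M (g -` ?F \<inter> space M)"
    using A F gM M by (intro emeasure_eq_AE) auto
  also have "\<dots> = emeasure (distr M borel g) ?F"
    using gM F by (simp add: emeasure_distr)
  also have "\<dots> = (\<Sum>i<N. ennreal (m i) * indicator ?F (g (p i)))"
    unfolding distr using F by (rule emeasure_particles)
  also have "\<dots> = (\<Sum>i<N. ennreal (m i) * indicator A (p i))"
    using in_F by (intro sum.cong refl arg_cong2[where f = "(*)"]) (simp add: indicator_def)
  also have "\<dots> = emeasure (particles N m p) A" using A by (simp add: emeasure_particles)
  finally show "emeasure M A = emeasure (particles N m p) A" .
qed (use M in simp)

subsection \<open>Disintegrations\<close>

text \<open>Finite intersections of members of a countable basis; the empty intersection contributes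
  \<open>UNIV\<close>. Countability lets almost-everywhere statements for single sets be combined
  into one for all measures of sets.\<close>

lemma borel_countable_generator:
  obtains E :: "'a::second_countable_topology set set"
  where "countable E" "Int_stable E" "UNIV \<in> E" "\<And>X. X \<in> E \<Longrightarrow> X \<in> sets borel"
    "sets borel = sigma_sets UNIV E"
proof -
  obtain B :: "'a set set" where B: "countable B" "topological_basis B"
    using ex_countable_basis by blast
  define E where "E = Inter ` {F. finite F \<and> F \<subseteq> B}"
  have "open b" if "b \<in> B" for b using that B(2) by (rule topological_basis_open[rotated])
  then have op: "X \<in> sets borel" if "X \<in> E" for X
    using that unfolding E_def by (auto intro!: borel_open open_Inter)
  have "B \<subseteq> E"
  proof
    fix b assume "b \<in> B"
    then have "b = \<Inter>{b}" "{b} \<subseteq> B" by auto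
    then show "b \<in> E" unfolding E_def by blast
  qed
  show thesis
  proof (rule that[of E])
    show "countable E" unfolding E_def
      by (intro countable_image countable_Collect_finite_subset B)
    show "UNIV \<in> E" unfolding E_def by (rule image_eqI[of _ _ "{}"]) auto
    show "Int_stable E"
    proof (rule Int_stableI)
      fix a b assume "a \<in> E" "b \<in> E"
      then obtain F G where "a = \<Inter>F" "b = \<Inter>G" "finite F" "finite G" "F \<subseteq> B" "G \<subseteq> B"
        unfolding E_def by blast
      then have "a \<inter> b = \<Inter>(F \<union> G)" "finite (F \<union> G)" "F \<union> G \<subseteq> B" by auto
      then show "a \<inter> b \<in> E" unfolding E_def by blast
    qed
    have "sets borel = sigma_sets UNIV B"
      unfolding borel_eq_countable_basis[OF B] by simp
    also have "\<dots> \<subseteq> sigma_sets UNIV E" using \<open>B \<subseteq> E\<close> by (rule sigma_sets_mono')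
    finally have "sets borel \<subseteq> sigma_sets UNIV E" .
    moreover have "sigma_sets UNIV E \<subseteq> sets borel"
      using op sets.sigma_sets_subset[of E borel] by auto
    ultimately show "sets borel = sigma_sets UNIV E" by blast
  qed (rule op)
qed

text \<open>For fixed \<open>B\<close> the functions \<open>emeasure (\<kappa> \<theta>) B\<close>
  and \<open>emeasure (\<kappa>' \<theta>) B\<close> are densities of the same finite measure, so
  they agree almost everywhere. A countable generator of the Borel sets makes the exceptional null
  set independent of \<open>B\<close>.\<close>

lemma disintegrates_unique:
  fixes \<gamma> :: "('a::topological_space \<times> 'b::second_countable_topology) measure"
  assumes \<kappa>: "disintegrates \<Theta> H G \<gamma> \<kappa>" and \<kappa>': "disintegrates \<Theta> H G \<gamma> \<kappa>'"
    and H: "H \<in> meas_pos \<Theta>" and \<gamma>: "finite_measure \<gamma>"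
  shows "AE \<theta> in H. \<kappa> \<theta> = \<kappa>' \<theta>"
proof -
  have sets_H: "sets H = sets borel" and H_\<Theta>: "AE \<theta> in H. \<theta> \<in> \<Theta>"
    using meas_posD[OF H] by auto
  have meas: "(\<lambda>\<theta>. emeasure (\<kappa> \<theta>) B) \<in> borel_measurable H" "(\<lambda>\<theta>. emeasure (\<kappa>' \<theta>) B) \<in> borel_measurable H"
    if "B \<in> sets borel" for B
    using that \<kappa> \<kappa>' by (auto simp: disintegrates_def)
  have int: "(\<integral>\<^sup>+\<theta>\<in>A. emeasure (\<kappa> \<theta>) B \<partial>H) = emeasure \<gamma> (A \<times> B)"
    "(\<integral>\<^sup>+\<theta>\<in>A. emeasure (\<kappa>' \<theta>) B \<partial>H) = emeasure \<gamma> (A \<times> B)"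
    if "A \<in> sets borel" "B \<in> sets borel" for A B
    using that \<kappa> \<kappa>' by (auto simp: disintegrates_def)
  have eq: "AE \<theta> in H. emeasure (\<kappa> \<theta>) B = emeasure (\<kappa>' \<theta>) B" if B: "B \<in> sets borel" for B
  proof -
    have "density H (\<lambda>\<theta>. emeasure (\<kappa> \<theta>) B) = density H (\<lambda>\<theta>. emeasure (\<kappa>' \<theta>) B)"
      by (rule measure_eqI) (use B sets_H in \<open>auto simp: emeasure_density meas int\<close>)
    moreover have "(\<integral>\<^sup>+\<theta>. emeasure (\<kappa> \<theta>) B \<partial>H) \<noteq> \<infinity>"
      using int(1)[of UNIV B] B finite_measure.emeasure_finite[OF \<gamma>] by simp
    ultimately show ?thesis using finite_density_unique[OF meas[OF B]] by simp
  qed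
  obtain E :: "'b set set" where E: "countable E" "Int_stable E" "UNIV \<in> E"
    "\<And>X. X \<in> E \<Longrightarrow> X \<in> sets borel" "sets borel = sigma_sets UNIV E"
    by (rule borel_countable_generator) (rule that)
  have "AE \<theta> in H. \<forall>B\<in>E. emeasure (\<kappa> \<theta>) B = emeasure (\<kappa>' \<theta>) B"
    using E by (subst AE_ball_countable) (auto intro: eq)
  with H_\<Theta> show ?thesis
  proof eventually_elim
    case (elim \<theta>)
    then have fin: "\<kappa> \<theta> \<in> meas_pos G" "\<kappa>' \<theta> \<in> meas_pos G"
      using \<kappa> \<kappa>' by (auto simp: disintegrates_def)
    show ?case
    proof (rule measure_eqI_generator_eq_countable[OF E(2), of UNIV _ _ "{UNIV}"])
      show "emeasure (\<kappa> \<theta>) a \<noteq> \<infinity>" for a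
        using finite_measure.emeasure_finite[OF meas_posD(2)[OF fin(1)]] by simp
    qed (use elim E fin[THEN meas_posD(1)] in auto)
  qed
qed

lemma emeasure_UNIV_Mv:
  assumes "sets M = sets borel"
  shows "emeasure (Mv t M) UNIV = emeasure M UNIV"
proof -
  have "(\<lambda>(x, v). x + t *\<^sub>R v) \<in> measurable M borel"
    using assms measurable_fst_add_scaleR by (simp cong: measurable_cong_sets)
  then show ?thesis
    using sets_eq_imp_space_eq[OF assms] by (simp add: Mv_def emeasure_distr)
qed

lemma emeasure_UNIV_Rd:
  assumes "sets M = sets borel"
  shows "emeasure (Rd \<theta> M) UNIV = emeasure M UNIV"
proof -
  have "(\<lambda>x. \<theta> \<bullet> x) \<in> measurable M borel"
    using assms by (simp cong: measurable_cong_sets)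
  then show ?thesis
    using sets_eq_imp_space_eq[OF assms] by (simp add: Rd_def emeasure_distr)
qed

subsection \<open>Generic projections\<close>

lemma infinite_UNIV_vec: "infinite (UNIV :: (real^'d) set)"
  using not_bounded_UNIV finite_imp_bounded by blast

text \<open>If \<open>s\<close> were the only time, a line through the position of particle 0 at
  time \<open>s\<close> whose velocity differs from every \<open>v i\<close> would be a
  ghost.\<close>

lemma two_times_if_no_ghost:
  fixes x v :: "nat \<Rightarrow> real^'d"
  assumes "\<not> has_ghost N m x v T'" and "0 < N" and "s \<in> T'"
  obtains t where "t \<in> T'" "t \<noteq> s"
proof (cases "T' \<subseteq> {s}")
  case True
  obtain w where w: "w \<notin> v ` {..<N}"
    using ex_new_if_finite[OF infinite_UNIV_vec, of "v ` {..<N}"] by auto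
  let ?y = "x 0 + s *\<^sub>R v 0 - s *\<^sub>R w"
  have "(?y, w) \<notin> supp (particles N m (\<lambda>i. (x i, v i)))"
    using supp_particles[of N m "\<lambda>i. (x i, v i)"] w by auto
  moreover have "\<forall>t\<in>T'. \<exists>i<N. ?y + t *\<^sub>R w = x i + t *\<^sub>R v i"
    using True \<open>0 < N\<close> by force
  ultimately show ?thesis using assms(1) unfolding has_ghost_def by blast
qed (use that in blast)

text \<open>Two observation times determine a line in space-time, so a projected line that meets a projected
  particle at every time in \<open>T'\<close> is the projection of one of finitely many candidate lines. For generic
  \<open>\<theta>\<close> the candidate already meets the unprojected particles; having no ghosts, it is a particle.\<close>

lemma generic_projection_no_ghost:
  fixes x v :: "nat \<Rightarrow> real^'d"
  assumes no_ghost: "\<not> has_ghost N m x v T'" and "finite T'" and "T' \<noteq> {}"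
  obtains W where "finite W" "0 \<notin> W"
    "\<And>\<theta> p q. (\<And>w. w \<in> W \<Longrightarrow> \<theta> \<bullet> w \<noteq> 0) \<Longrightarrow>
      (\<And>t. t \<in> T' \<Longrightarrow> \<exists>i<N. p + t * q = \<theta> \<bullet> (x i + t *\<^sub>R v i)) \<Longrightarrow>
      \<exists>k<N. p = \<theta> \<bullet> x k \<and> q = \<theta> \<bullet> v k"
proof (cases "N = 0")
  case True
  then show ?thesis using that[of "{}"] \<open>T' \<noteq> {}\<close> by auto
next
  case False
  obtain s where s: "s \<in> T'" using \<open>T' \<noteq> {}\<close> by blast
  obtain t where t: "t \<in> T'" "t \<noteq> s" using two_times_if_no_ghost[OF no_ghost _ s] False by blast
  define z where "z r i = x i + r *\<^sub>R v i" for r i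
  \<comment> \<open>\<open>V i j\<close> and, below, \<open>X i j\<close> are the velocity and the
    position at time 0 of the line through \<open>z s i\<close> at time \<open>s\<close> and
    \<open>z t j\<close> at time \<open>t\<close>.\<close>
  define V where "V i j = (1 / (t - s)) *\<^sub>R (z t j - z s i)" for i j
  define X where "X i j = z s i - s *\<^sub>R V i j" for i j
  \<comment> \<open>The nonzero gaps between a candidate line and a particle at a time in
    \<open>T'\<close>. If no gap is orthogonal to \<open>\<theta>\<close>, equality after projection
    implies equality before it.\<close>
  define W where "W = (\<lambda>(i, j, r, k). X i j + r *\<^sub>R V i j - z r k) ` ({..<N} \<times> {..<N} \<times> T' \<times> {..<N}) - {0}"
  show ?thesis
  proof (rule that[of W])
    show "finite W" unfolding W_def using \<open>finite T'\<close> by simp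
    show "0 \<notin> W" by (simp add: W_def)
  next
    fix \<theta> p q
    assume generic: "\<And>w. w \<in> W \<Longrightarrow> \<theta> \<bullet> w \<noteq> 0"
      and meets: "\<And>t. t \<in> T' \<Longrightarrow> \<exists>i<N. p + t * q = \<theta> \<bullet> (x i + t *\<^sub>R v i)"
    obtain i where i: "i < N" "p + s * q = \<theta> \<bullet> z s i" using meets[OF s] by (auto simp: z_def)
    obtain j where j: "j < N" "p + t * q = \<theta> \<bullet> z t j" using meets[OF t(1)] by (auto simp: z_def)
    have "(t - s) * q = \<theta> \<bullet> (z t j - z s i)"
      using i j by (simp add: inner_diff_right algebra_simps)
    then have q: "q = \<theta> \<bullet> V i j" using t by (simp add: V_def nonzero_eq_divide_eq mult.commute)
    then have p: "p = \<theta> \<bullet> X i j" using i by (simp add: X_def inner_diff_right)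
    have "\<forall>r\<in>T'. \<exists>k<N. X i j + r *\<^sub>R V i j = x k + r *\<^sub>R v k"
    proof
      fix r assume r: "r \<in> T'"
      then obtain k where k: "k < N" "p + r * q = \<theta> \<bullet> z r k" using meets by (auto simp: z_def)
      then have "\<theta> \<bullet> (X i j + r *\<^sub>R V i j - z r k) = 0"
        by (simp add: p q inner_diff_right inner_add_right)
      moreover have "X i j + r *\<^sub>R V i j - z r k \<in> insert 0 W"
        unfolding W_def using i j k r by (force intro: image_eqI[of _ _ "(i, j, r, k)"])
      ultimately have "X i j + r *\<^sub>R V i j - z r k = 0" using generic by blast
      then show "\<exists>k<N. X i j + r *\<^sub>R V i j = x k + r *\<^sub>R v k" using k by (auto simp: z_def)
    qed
    \<comment> \<open>The candidate meets a particle at every time in \<open>T'\<close>, so outside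
      the support it would be a ghost.\<close>
    then have "(X i j, V i j) \<in> supp (particles N m (\<lambda>i. (x i, v i)))"
      using no_ghost unfolding has_ghost_def by blast
    then have "(X i j, V i j) \<in> (\<lambda>i. (x i, v i)) ` {..<N}"
      using supp_particles[of N m "\<lambda>i. (x i, v i)"] by (rule subsetD[rotated])
    then show "\<exists>k<N. p = \<theta> \<bullet> x k \<and> q = \<theta> \<bullet> v k" by (auto simp: p q)
  qed
qed

lemma AE_particles_if_distr_eq:
  fixes p :: "nat \<Rightarrow> 'b::t1_space"
  assumes "sets M = sets borel" and "g \<in> borel_measurable borel"
    and "distr M borel g = particles N m p"
  shows "AE z in M. \<exists>i<N. g z = p i"
proof -
  have "g \<in> borel_measurable M" using assms by (simp cong: measurable_cong_sets)
  moreover have "AE z in distr M borel g. z \<in> p ` {..<N}"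
    unfolding assms(3) by (rule AE_particles_support)
  ultimately have "AE z in M. g z \<in> p ` {..<N}" by (rule AE_distrD)
  then show ?thesis by eventually_elim auto
qed

text \<open>Off finitely many null sets of directions, the slice lives on the projected particles.
  Moving to a single time \<open>s\<close> is injective there, so the known moved measure determines
  the slice.\<close>

lemma AE_slices_eq_Rj:
  fixes x v :: "nat \<Rightarrow> real^'d"
  assumes generic: "\<And>w. w \<noteq> 0 \<Longrightarrow> AE \<theta> in H. \<theta> \<bullet> w \<noteq> 0"
    and "finite T'" and "T' \<noteq> {}"
    and no_coincidence: "\<And>t. t \<in> T' \<Longrightarrow> \<not> has_coincidence N x v t"
    and no_ghost: "\<not> has_ghost N m x v T'"
    and sets: "AE \<theta> in H. sets (\<kappa> \<theta>) = sets borel"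
    and Mv: "\<And>t. t \<in> T' \<Longrightarrow> AE \<theta> in H. Mv t (\<kappa> \<theta>) = particles N m (\<lambda>i. \<theta> \<bullet> (x i + t *\<^sub>R v i))"
  shows "AE \<theta> in H. \<kappa> \<theta> = Rj \<theta> (particles N m (\<lambda>i. (x i, v i)))"
proof -
  obtain W where W: "finite W" "0 \<notin> W"
    and proj: "\<And>\<theta> p q. (\<And>w. w \<in> W \<Longrightarrow> \<theta> \<bullet> w \<noteq> 0) \<Longrightarrow>
      (\<And>t. t \<in> T' \<Longrightarrow> \<exists>i<N. p + t * q = \<theta> \<bullet> (x i + t *\<^sub>R v i)) \<Longrightarrow>
      \<exists>k<N. p = \<theta> \<bullet> x k \<and> q = \<theta> \<bullet> v k"
    using generic_projection_no_ghost[OF no_ghost \<open>finite T'\<close> \<open>T' \<noteq> {}\<close>] by metis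
  obtain s where s: "s \<in> T'" using \<open>T' \<noteq> {}\<close> by blast
  let ?z = "\<lambda>t i. x i + t *\<^sub>R v i"
  have "AE \<theta> in H. \<forall>w\<in>W. \<theta> \<bullet> w \<noteq> 0"
    using W by (intro AE_finite_allI generic) auto
  \<comment> \<open>Particles distinct at time \<open>s\<close> stay distinct after projection in
    almost every direction; this is where the absence of coincidences enters.\<close>
  moreover have "AE \<theta> in H. \<forall>i\<in>{..<N}. \<forall>j\<in>{..<N}. i \<noteq> j \<longrightarrow> \<theta> \<bullet> (?z s i - ?z s j) \<noteq> 0"
  proof (intro AE_finite_allI)
    fix i j assume "i \<in> {..<N}" "j \<in> {..<N}"
    then show "AE \<theta> in H. i \<noteq> j \<longrightarrow> \<theta> \<bullet> (?z s i - ?z s j) \<noteq> 0"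
      using no_coincidence[OF s] generic[of "?z s i - ?z s j"]
      by (cases "i = j") (auto simp: has_coincidence_def)
  qed auto
  moreover have "AE \<theta> in H. \<forall>t\<in>T'. Mv t (\<kappa> \<theta>) = particles N m (\<lambda>i. \<theta> \<bullet> ?z t i)"
    using \<open>finite T'\<close> by (intro AE_finite_allI Mv)
  ultimately show ?thesis
    using sets
  proof eventually_elim
    case (elim \<theta>)
    have "\<kappa> \<theta> = particles N m (\<lambda>i. (\<theta> \<bullet> x i, \<theta> \<bullet> v i))"
    proof (rule eq_particlesI[of _ "\<lambda>(p, q). p + s *\<^sub>R q"])
      have "AE pq in \<kappa> \<theta>. \<forall>t\<in>T'. \<exists>i<N. (\<lambda>(p, q). p + t *\<^sub>R q) pq = \<theta> \<bullet> ?z t i"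
        using elim \<open>finite T'\<close>
        by (intro AE_finite_allI AE_particles_if_distr_eq[where m = m]) (auto simp: Mv_def simp del: real_scaleR_def)
      then show "AE pq in \<kappa> \<theta>. pq \<in> (\<lambda>i. (\<theta> \<bullet> x i, \<theta> \<bullet> v i)) ` {..<N}"
      proof eventually_elim
        case (elim pq)
        then show ?case
          using proj[of \<theta> "fst pq" "snd pq"] \<open>\<forall>w\<in>W. \<theta> \<bullet> w \<noteq> 0\<close> by (cases pq) auto
      qed
      show "distr (\<kappa> \<theta>) borel (\<lambda>(p, q). p + s *\<^sub>R q) =
          particles N m (\<lambda>i. case (\<theta> \<bullet> x i, \<theta> \<bullet> v i) of (p, q) \<Rightarrow> p + s *\<^sub>R q)"
        using elim s by (simp add: Mv_def inner_add_right)
      show "inj_on (\<lambda>(p, q). p + s *\<^sub>R q) ((\<lambda>i. (\<theta> \<bullet> x i, \<theta> \<bullet> v i)) ` {..<N})"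
      proof (rule inj_onI, clarify)
        fix i j assume "i < N" "j < N" "\<theta> \<bullet> x i + s *\<^sub>R (\<theta> \<bullet> v i) = \<theta> \<bullet> x j + s *\<^sub>R (\<theta> \<bullet> v j)"
        then have "\<theta> \<bullet> (?z s i - ?z s j) = 0" by (simp add: inner_diff_right inner_add_right)
        then have "i = j" using elim \<open>i < N\<close> \<open>j < N\<close> by blast
        then show "\<theta> \<bullet> x i = \<theta> \<bullet> x j \<and> \<theta> \<bullet> v i = \<theta> \<bullet> v j" by simp
      qed
    qed (use elim in simp, rule measurable_fst_add_scaleR)
    then show ?case by (simp add: Rj_particles)
  qed
qed

text \<open>A point \<open>y\<close> off the finite set \<open>z ` {..<N}\<close> is projected onto the projection of that set only by a
  null set of directions \<open>\<theta>\<close>. By Fubini, this yields that \<open>\<nu>\<close> is concentrated on \<open>z ` {..<N}\<close>.\<close>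

lemma eq_particles_if_AE_Rd_eq:
  fixes z :: "nat \<Rightarrow> real^'d"
  assumes generic: "\<And>w. w \<noteq> 0 \<Longrightarrow> AE \<theta> in H. \<theta> \<bullet> w \<noteq> 0"
    and "prob_space H" and sets_H: "sets H = sets borel"
    and \<nu>: "finite_measure \<nu>" "sets \<nu> = sets borel"
    and Rd: "AE \<theta> in H. Rd \<theta> \<nu> = particles N m (\<lambda>i. \<theta> \<bullet> z i)"
  shows "\<nu> = particles N m z"
proof -
  interpret H: prob_space H by fact
  interpret N: finite_measure \<nu> by fact
  interpret P: pair_sigma_finite H \<nu> ..
  have sets_P: "sets (H \<Otimes>\<^sub>M \<nu>) = sets borel"
    using sets_pair_measure_cong[OF sets_H \<nu>(2)] unfolding borel_prod .
  have "AE \<theta> in H. AE y in \<nu>. \<exists>i<N. \<theta> \<bullet> y = \<theta> \<bullet> z i"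
    using Rd
  proof eventually_elim
    case (elim \<theta>)
    then show ?case
      by (intro AE_particles_if_distr_eq[OF \<nu>(2), where m = m]) (auto simp: Rd_def)
  qed
  \<comment> \<open>Fubini for almost-everywhere statements needs this set to be measurable; it is a
    finite union of closed sets.\<close>
  moreover have "{\<xi> \<in> space (H \<Otimes>\<^sub>M \<nu>). \<exists>i<N. fst \<xi> \<bullet> snd \<xi> = fst \<xi> \<bullet> z i} \<in> sets (H \<Otimes>\<^sub>M \<nu>)"
  proof -
    have "closed (\<Union>i<N. {\<xi> :: (real^'d) \<times> (real^'d). fst \<xi> \<bullet> snd \<xi> = fst \<xi> \<bullet> z i})"
      by (intro closed_UN ballI closed_Collect_eq continuous_intros) auto
    moreover have "space (H \<Otimes>\<^sub>M \<nu>) = UNIV"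
      using sets_eq_imp_space_eq[OF sets_P] by simp
    moreover have "{\<xi>. \<exists>i<N. fst \<xi> \<bullet> snd \<xi> = fst \<xi> \<bullet> z i} =
        (\<Union>i<N. {\<xi> :: (real^'d) \<times> (real^'d). fst \<xi> \<bullet> snd \<xi> = fst \<xi> \<bullet> z i})" by auto
    ultimately show ?thesis by (simp add: sets_P borel_closed)
  qed
  ultimately have "AE y in \<nu>. AE \<theta> in H. \<exists>i<N. \<theta> \<bullet> y = \<theta> \<bullet> z i"
    by (subst (asm) P.AE_commute)
  then have supp: "AE y in \<nu>. y \<in> z ` {..<N}"
  proof eventually_elim
    case (elim y)
    show ?case
    proof (rule ccontr)
      assume y: "y \<notin> z ` {..<N}"
      have "AE \<theta> in H. \<forall>i\<in>{..<N}. \<theta> \<bullet> (y - z i) \<noteq> 0"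
        by (intro AE_finite_allI generic) (use y in auto)
      then have "AE \<theta> in H. False"
        using elim by eventually_elim (auto simp: inner_diff_right)
      then show False by simp
    qed
  qed
  \<comment> \<open>Several \<open>z i\<close> may coincide, as happens at times outside
    \<open>T'\<close>. Therefore only nonzero differences are considered, and injectivity is claimed
    on the set of positions rather than on the indices.\<close>
  have "AE \<theta> in H. \<forall>w\<in>(\<lambda>(i, j). z i - z j) ` ({..<N} \<times> {..<N}) - {0}. \<theta> \<bullet> w \<noteq> 0"
    by (intro AE_finite_allI generic) auto
  then have "AE \<theta> in H. Rd \<theta> \<nu> = particles N m (\<lambda>i. \<theta> \<bullet> z i) \<and> inj_on ((\<bullet>) \<theta>) (z ` {..<N})"
    using Rd
  proof eventually_elim
    case (elim \<theta>)
    have "inj_on ((\<bullet>) \<theta>) (z ` {..<N})"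
    proof (rule inj_onI, clarify, rule ccontr)
      fix i j assume "i < N" "j < N" and eq: "\<theta> \<bullet> z i = \<theta> \<bullet> z j" "z i \<noteq> z j"
      then have "z i - z j \<in> (\<lambda>(i, j). z i - z j) ` ({..<N} \<times> {..<N}) - {0}" by force
      then have "\<theta> \<bullet> (z i - z j) \<noteq> 0" using elim by blast
      then show False using eq by (simp add: inner_diff_right)
    qed
    then show ?case using elim by simp
  qed
  \<comment> \<open>One good direction suffices from here on, and it exists because \<open>H\<close>
    is a probability measure.\<close>
  then obtain \<theta> where "Rd \<theta> \<nu> = particles N m (\<lambda>i. \<theta> \<bullet> z i)" "inj_on ((\<bullet>) \<theta>) (z ` {..<N})"
    using eventually_happens'[OF H.ae_filter_bot] by blast
  then show ?thesis
    by (intro eq_particlesI[of _ "(\<bullet>) \<theta>"]) (auto simp: \<nu> supp Rd_def)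
qed

subsection \<open>The ground truth as a competitor\<close>

lemma particles_in_meas_pos:
  assumes "\<And>i. i < N \<Longrightarrow> 0 < m i \<Longrightarrow> p i \<in> X"
  shows "particles N m p \<in> meas_pos (X :: 'a::t1_space set)"
proof -
  let ?P = "p ` {i. i < N \<and> 0 < m i}"
  have "AE z in particles N m p. z \<in> ?P"
    by (subst AE_particles) (auto intro!: borel_closed finite_imp_closed)
  then have "AE z in particles N m p. z \<in> X"
    by eventually_elim (use assms in auto)
  then show ?thesis by (simp add: meas_pos_def)
qed

text \<open>The measure with slices \<open>Rj \<theta> \<mu>\<close>, encoded as a pushforward of a
  product so that it is a measure by construction.\<close>

definition joint_Rj :: "(real^'d) measure \<Rightarrow> ((real^'d) \<times> (real^'d)) measure \<Rightarrow> ((real^'d) \<times> real \<times> real) measure" where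
  "joint_Rj H \<mu> = distr (H \<Otimes>\<^sub>M \<mu>) borel (\<lambda>(\<theta>, x, v). (\<theta>, \<theta> \<bullet> x, \<theta> \<bullet> v))"

lemma sets_joint_Rj [simp]: "sets (joint_Rj H \<mu>) = sets borel"
  by (simp add: joint_Rj_def)

lemma measurable_joint_Rj:
  assumes "sets H = sets borel" and "sets \<mu> = sets borel"
  shows "(\<lambda>(\<theta>, x, v). (\<theta>, \<theta> \<bullet> x, \<theta> \<bullet> v)) \<in> H \<Otimes>\<^sub>M \<mu> \<rightarrow>\<^sub>M
    (borel :: ((real^'d) \<times> real \<times> real) measure)"
proof -
  have "sets (H \<Otimes>\<^sub>M \<mu>) = sets borel"
    using sets_pair_measure_cong[OF assms] unfolding borel_prod .
  then show ?thesis
    unfolding case_prod_beta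
    by (subst measurable_cong_sets[OF _ refl])
       (auto intro!: borel_measurable_continuous_onI continuous_intros)
qed

text \<open>Integrate over sections: the section of the preimage of \<open>A \<times> B\<close> at
  \<open>\<theta>\<close> is the preimage of \<open>B\<close> under the projection if
  \<open>\<theta> \<in> A\<close>, and empty otherwise.\<close>

lemma emeasure_joint_Rj:
  assumes H: "sets H = sets borel" and \<mu>: "sets \<mu> = sets borel" "finite_measure \<mu>"
    and A: "A \<in> sets borel" and B: "B \<in> sets borel"
  shows "emeasure (joint_Rj H \<mu>) (A \<times> B) = (\<integral>\<^sup>+\<theta>\<in>A. emeasure (Rj \<theta> \<mu>) B \<partial>H)"
proof -
  interpret finite_measure \<mu> by fact
  have space: "space H = UNIV" "space \<mu> = UNIV"
    using sets_eq_imp_space_eq[OF H] sets_eq_imp_space_eq[OF \<mu>(1)] by auto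
  let ?J = "\<lambda>(\<theta>, x, v). (\<theta>, \<theta> \<bullet> x, \<theta> \<bullet> v)"
  have AB: "A \<times> B \<in> sets borel" using A B by (metis borel_prod pair_measureI)
  have J: "?J \<in> H \<Otimes>\<^sub>M \<mu> \<rightarrow>\<^sub>M borel" using H \<mu>(1) by (rule measurable_joint_Rj)
  have "emeasure (joint_Rj H \<mu>) (A \<times> B) = emeasure (H \<Otimes>\<^sub>M \<mu>) (?J -` (A \<times> B) \<inter> space (H \<Otimes>\<^sub>M \<mu>))"
    unfolding joint_Rj_def using J AB by (rule emeasure_distr)
  also have "\<dots> = (\<integral>\<^sup>+\<theta>. emeasure \<mu> (Pair \<theta> -` (?J -` (A \<times> B) \<inter> space (H \<Otimes>\<^sub>M \<mu>))) \<partial>H)"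
    using J AB by (intro emeasure_pair_measure_alt measurable_sets)
  also have "\<dots> = (\<integral>\<^sup>+\<theta>\<in>A. emeasure (Rj \<theta> \<mu>) B \<partial>H)"
  proof (intro nn_integral_cong)
    fix \<theta>
    have "Pair \<theta> -` (?J -` (A \<times> B) \<inter> space (H \<Otimes>\<^sub>M \<mu>)) =
        (if \<theta> \<in> A then (\<lambda>(x, v). (\<theta> \<bullet> x, \<theta> \<bullet> v)) -` B \<inter> space \<mu> else {})"
      by (auto simp: space_pair_measure space)
    moreover have "emeasure (Rj \<theta> \<mu>) B = emeasure \<mu> ((\<lambda>(x, v). (\<theta> \<bullet> x, \<theta> \<bullet> v)) -` B \<inter> space \<mu>)"
      unfolding Rj_def using \<mu>(1) B measurable_inner_pair
      by (intro emeasure_distr) (auto cong: measurable_cong_sets)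
    ultimately show "emeasure \<mu> (Pair \<theta> -` (?J -` (A \<times> B) \<inter> space (H \<Otimes>\<^sub>M \<mu>))) =
        emeasure (Rj \<theta> \<mu>) B * indicator A \<theta>" by simp
  qed
  finally show ?thesis .
qed

lemma joint_Rj_particles_in_meas_pos:
  fixes x v :: "nat \<Rightarrow> real^'d"
  assumes "compact \<Theta>" and H: "H \<in> meas_pos \<Theta>"
    and Lam: "\<And>i. i < N \<Longrightarrow> 0 < m i \<Longrightarrow> (x i, v i) \<in> Lam \<Omega> Sig"
  shows "joint_Rj H (particles N m (\<lambda>i. (x i, v i))) \<in> meas_pos (\<Theta> \<times> Gam \<Omega> Sig \<Theta>)"
proof -
  let ?\<mu> = "particles N m (\<lambda>i. (x i, v i))"
  let ?J = "\<lambda>(\<theta>, x, v). (\<theta>, \<theta> \<bullet> x, \<theta> \<bullet> v)"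
  interpret H: finite_measure H using H by (rule meas_posD)
  interpret \<mu>: finite_measure ?\<mu> by simp
  interpret P: pair_sigma_finite H ?\<mu> ..
  \<comment> \<open>A compact, hence Borel, carrier inside
    \<open>\<Theta> \<times> Gam \<Omega> Sig \<Theta>\<close>, swept out by the projections of the
    particles of positive mass. Its measurability permits passing through the product and the
    pushforward.\<close>
  define K where "K = (\<Union>i\<in>{i. i < N \<and> 0 < m i}. (\<lambda>\<theta>. (\<theta>, \<theta> \<bullet> x i, \<theta> \<bullet> v i)) ` \<Theta>)"
  have "compact K" unfolding K_def
    using \<open>compact \<Theta>\<close> by (intro compact_UN compact_continuous_image continuous_intros) auto
  then have K: "K \<in> sets borel" by (rule borel_compact)
  have J: "?J \<in> H \<Otimes>\<^sub>M ?\<mu> \<rightarrow>\<^sub>M borel"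
    using meas_posD(1)[OF H] by (intro measurable_joint_Rj) auto
  have "AE \<theta> in H. AE \<xi> in ?\<mu>. ?J (\<theta>, \<xi>) \<in> K"
    using meas_posD(3)[OF H]
  proof eventually_elim
    case (elim \<theta>)
    have "(\<lambda>\<xi>. ?J (\<theta>, \<xi>)) \<in> borel_measurable borel"
      unfolding case_prod_beta by (intro borel_measurable_continuous_onI continuous_intros)
    then have "{\<xi>. ?J (\<theta>, \<xi>) \<in> K} \<in> sets borel"
      using measurable_sets[OF _ K, of "\<lambda>\<xi>. ?J (\<theta>, \<xi>)" borel] by (simp add: vimage_def)
    moreover have "?J (\<theta>, x i, v i) \<in> K" if "i < N" "0 < m i" for i
      unfolding K_def by (rule UN_I[of i]) (use elim that in auto)
    ultimately show ?case by (subst AE_particles) auto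
  qed
  then have "AE z in H \<Otimes>\<^sub>M ?\<mu>. ?J z \<in> K"
    using measurable_sets[OF J K]
    by (intro P.AE_pair_measure) (auto simp: vimage_def Int_def conj_commute)
  then have "AE z in joint_Rj H ?\<mu>. z \<in> K"
    unfolding joint_Rj_def using K by (subst AE_distr_iff[OF J]) auto
  moreover have "K \<subseteq> \<Theta> \<times> Gam \<Omega> Sig \<Theta>"
    using Lam by (auto simp: K_def Gam_def)
  ultimately have "AE z in joint_Rj H ?\<mu>. z \<in> \<Theta> \<times> Gam \<Omega> Sig \<Theta>"
    by (auto elim: eventually_mono)
  moreover have "finite_measure (joint_Rj H ?\<mu>)"
    unfolding joint_Rj_def by (intro finite_measure.finite_measure_distr[OF _ J] finite_measure_pair_measure) unfold_locales
  ultimately show ?thesis by (simp add: meas_pos_def)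
qed

lemma disintegrates_joint_Rj_particles:
  fixes x v :: "nat \<Rightarrow> real^'d"
  assumes H: "H \<in> meas_pos \<Theta>"
    and Lam: "\<And>i. i < N \<Longrightarrow> 0 < m i \<Longrightarrow> (x i, v i) \<in> Lam \<Omega> Sig"
  shows "disintegrates \<Theta> H (Gam \<Omega> Sig \<Theta>) (joint_Rj H (particles N m (\<lambda>i. (x i, v i))))
    (\<lambda>\<theta>. Rj \<theta> (particles N m (\<lambda>i. (x i, v i))))"
  unfolding disintegrates_def
proof (intro conjI ballI)
  note sets_H [measurable_cong] = meas_posD(1)[OF H]
  let ?\<mu> = "particles N m (\<lambda>i. (x i, v i))"
  show "Rj \<theta> ?\<mu> \<in> meas_pos (Gam \<Omega> Sig \<Theta>)" if "\<theta> \<in> \<Theta>" for \<theta>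
    unfolding Rj_particles by (rule particles_in_meas_pos) (use Lam that in \<open>auto simp: Gam_def\<close>)
  show "(\<lambda>\<theta>. emeasure (Rj \<theta> ?\<mu>) B) \<in> borel_measurable H" if [measurable]: "B \<in> sets borel" for B
    unfolding Rj_particles emeasure_particles[OF that] by measurable
  show "emeasure (joint_Rj H ?\<mu>) (A \<times> B) = (\<integral>\<^sup>+\<theta>\<in>A. emeasure (Rj \<theta> ?\<mu>) B \<partial>H)"
    if "A \<in> sets borel" "B \<in> sets borel" for A B
    using sets_H that by (intro emeasure_joint_Rj) auto
qed

text \<open>Moving and projecting commute, since \<open>\<theta> \<bullet> (x + t v)\<close> equals
  \<open>\<theta> \<bullet> x + t (\<theta> \<bullet> v)\<close>.\<close>

lemma feasible_joint_Rj:
  fixes x v :: "nat \<Rightarrow> real^'d"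
  assumes "compact \<Theta>" and H: "H \<in> meas_pos \<Theta>"
    and \<mu>: "\<mu> = particles N m (\<lambda>i. (x i, v i))" "\<mu> \<in> meas_pos (Lam \<Omega> Sig)"
    and Ob: "\<And>t. t \<in> T \<Longrightarrow> Ob t (Mv t \<mu>) = f t"
  shows "feasible Sig T \<Omega> \<Theta> H Ob f (\<lambda>t. Mv t \<mu>) (joint_Rj H \<mu>)"
proof -
  have "AE \<xi> in particles N m (\<lambda>i. (x i, v i)). \<xi> \<in> Lam \<Omega> Sig"
    using meas_posD(3)[OF \<mu>(2)] unfolding \<mu>(1) .
  then have Lam: "(x i, v i) \<in> Lam \<Omega> Sig" if "i < N" "0 < m i" for i
    using that by (rule AE_particles_imp)
  have "Mv t \<mu> \<in> meas_pos \<Omega>" if "t \<in> Sig" for t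
    unfolding \<mu>(1) Mv_particles by (rule particles_in_meas_pos) (use Lam that in \<open>auto simp: Lam_def\<close>)
  moreover have "Mv t (Rj \<theta> \<mu>) = Rd \<theta> (Mv t \<mu>)" for t \<theta>
    unfolding \<mu>(1) Mv_particles Rj_particles Rd_particles by (simp add: inner_add_right)
  moreover have "joint_Rj H \<mu> \<in> meas_pos (\<Theta> \<times> Gam \<Omega> Sig \<Theta>)"
    unfolding \<mu>(1) using \<open>compact \<Theta>\<close> H Lam by (rule joint_Rj_particles_in_meas_pos)
  moreover have "disintegrates \<Theta> H (Gam \<Omega> Sig \<Theta>) (joint_Rj H \<mu>) (\<lambda>\<theta>. Rj \<theta> \<mu>)"
    unfolding \<mu>(1) using H Lam by (rule disintegrates_joint_Rj_particles)
  ultimately show ?thesis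
    unfolding feasible_def using Ob by (auto intro!: exI[of _ "\<lambda>\<theta>. Rj \<theta> \<mu>"])
qed

lemma emeasure_disintegrates:
  assumes "disintegrates \<Theta> H G \<gamma> \<kappa>"
  shows "emeasure \<gamma> UNIV = (\<integral>\<^sup>+\<theta>. emeasure (\<kappa> \<theta>) UNIV \<partial>H)"
proof -
  have "\<forall>A\<in>sets borel. \<forall>B\<in>sets borel. emeasure \<gamma> (A \<times> B) = (\<integral>\<^sup>+\<theta>\<in>A. emeasure (\<kappa> \<theta>) B \<partial>H)"
    using assms by (simp add: disintegrates_def)
  from this[THEN bspec, THEN bspec, of UNIV UNIV] show ?thesis by simp
qed

text \<open>Moving and projecting preserve total mass, so almost every slice has the mass of
  \<open>u t\<close>; integrate over the probability measure \<open>H\<close>.\<close>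

lemma tv_norm_feasible:
  assumes "feasible Sig T \<Omega> \<Theta> H Ob f u \<gamma>" and "t \<in> Sig"
    and H: "H \<in> meas_pos \<Theta>" "prob_space H"
  shows "tv_norm \<gamma> = tv_norm (u t)"
proof -
  interpret prob_space H by fact
  obtain \<kappa> where \<kappa>: "disintegrates \<Theta> H (Gam \<Omega> Sig \<Theta>) \<gamma> \<kappa>"
    and Mv: "AE \<theta> in H. Mv t (\<kappa> \<theta>) = Rd \<theta> (u t)"
    and u: "u t \<in> meas_pos \<Omega>" and \<gamma>: "\<gamma> \<in> meas_pos (\<Theta> \<times> Gam \<Omega> Sig \<Theta>)"
    using assms(1,2) unfolding feasible_def by blast
  have "emeasure \<gamma> UNIV = (\<integral>\<^sup>+\<theta>. emeasure (\<kappa> \<theta>) UNIV \<partial>H)"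
    using \<kappa> by (rule emeasure_disintegrates)
  also have "\<dots> = (\<integral>\<^sup>+\<theta>. emeasure (u t) UNIV \<partial>H)"
  proof (rule nn_integral_cong_AE)
    show "AE \<theta> in H. emeasure (\<kappa> \<theta>) UNIV = emeasure (u t) UNIV"
      using Mv meas_posD(3)[OF H(1)]
    proof eventually_elim
      case (elim \<theta>)
      then have "sets (\<kappa> \<theta>) = sets borel" using \<kappa> by (auto simp: disintegrates_def dest: meas_posD)
      then show ?case using elim emeasure_UNIV_Mv emeasure_UNIV_Rd meas_posD(1)[OF u] by metis
    qed
  qed
  also have "\<dots> = emeasure (u t) UNIV" by (simp add: emeasure_space_1)
  finally show ?thesis
    using sets_eq_imp_space_eq[OF meas_posD(1)[OF u]] sets_eq_imp_space_eq[OF meas_posD(1)[OF \<gamma>]]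
    by (simp add: tv_norm_def measure_def)
qed

subsection \<open>Exact reconstruction\<close>

theorem theorem3:
  fixes \<Omega> \<Theta> :: "(real^'d) set" and Sig T T' :: "real set"
    and H :: "(real^'d) measure"
    and Ob :: "real \<Rightarrow> (real^'d) measure \<Rightarrow> 'h::{real_inner, complete_space}"
    and Ob_pre :: "real \<Rightarrow> 'h \<Rightarrow> real^'d \<Rightarrow> real"
    and N :: nat and m :: "nat \<Rightarrow> real" and x v :: "nat \<Rightarrow> real^'d"
    and lam0 :: "((real^'d) \<times> (real^'d)) measure" and u0 :: "real \<Rightarrow> (real^'d) measure"
    and f0 :: "real \<Rightarrow> 'h"
    and u :: "real \<Rightarrow> (real^'d) measure" and \<gamma> :: "((real^'d) \<times> real \<times> real) measure"
  assumes "compact \<Omega>" and "compact Sig" and "compact \<Theta>" and "\<Theta> \<subseteq> sphere 0 1"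
    and "finite T" and "T \<noteq> {}" and "T \<subseteq> Sig"
    and "H \<in> meas_pos \<Theta>" and "prob_space H" and "supp H = \<Theta>"
    and "has_nonzero_lsc_density H"
    and "\<And>t. t \<in> T \<Longrightarrow> bounded_linear_into_C \<Omega> (Ob_pre t)"
    and "\<And>t. t \<in> T \<Longrightarrow> is_dual_of \<Omega> (Ob t) (Ob_pre t)"
    and "\<And>i. i < N \<Longrightarrow> m i \<ge> 0"
    and lam0: "lam0 = particles N m (\<lambda>i. (x i, v i))"
    and "lam0 \<in> meas_pos (Lam \<Omega> Sig)"
    and u0: "\<And>t. u0 t = Mv t lam0"
    and f0: "\<And>t. f0 t = Ob t (u0 t)"
    and "T' \<noteq> {}" and "T' \<subseteq> T"
    and unique: "\<And>t w. t \<in> T' \<Longrightarrow>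
        is_arg_min tv_norm (\<lambda>w'. w' \<in> meas_pos \<Omega> \<and> Ob t w' = f0 t) w \<longleftrightarrow> w = u0 t"
    and no_coincidence: "\<And>t. t \<in> T' \<Longrightarrow> \<not> has_coincidence N x v t"
    and no_ghost: "\<not> has_ghost N m x v T'"
    and solution: "is_arg_min (\<lambda>(u', \<gamma>'). tv_norm \<gamma>')
        (\<lambda>(u', \<gamma>'). feasible Sig T \<Omega> \<Theta> H Ob f0 u' \<gamma>') (u, \<gamma>)"
  shows "(\<forall>t\<in>Sig. u t = u0 t) \<and>
    (\<forall>\<kappa>. disintegrates \<Theta> H (Gam \<Omega> Sig \<Theta>) \<gamma> \<kappa> \<longrightarrow> (AE \<theta> in H. \<kappa> \<theta> = Rj \<theta> lam0))"
proof -
  note H = \<open>H \<in> meas_pos \<Theta>\<close> \<open>prob_space H\<close>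
  have sub: "T' \<subseteq> Sig" "finite T'"
    using \<open>T' \<subseteq> T\<close> \<open>T \<subseteq> Sig\<close> \<open>finite T\<close> finite_subset by auto
  have generic: "AE \<theta> in H. \<theta> \<bullet> w \<noteq> 0" if "w \<noteq> 0" for w
    using \<open>has_nonzero_lsc_density H\<close> that by (rule AE_inner_nonzero)
  have u0_eq: "u0 t = particles N m (\<lambda>i. x i + t *\<^sub>R v i)" for t
    by (simp add: u0 lam0 Mv_particles)

  have feas: "feasible Sig T \<Omega> \<Theta> H Ob f0 u \<gamma>"
    using solution by (simp add: is_arg_min_def)
  have feas0: "feasible Sig T \<Omega> \<Theta> H Ob f0 u0 (joint_Rj H lam0)"
    using feasible_joint_Rj[OF \<open>compact \<Theta>\<close> H(1) lam0 \<open>lam0 \<in> _\<close>, of T Ob f0]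
    by (simp add: f0 u0[abs_def])
  obtain \<kappa> where \<kappa>: "disintegrates \<Theta> H (Gam \<Omega> Sig \<Theta>) \<gamma> \<kappa>"
    and Mv_\<kappa>: "\<And>t. t \<in> Sig \<Longrightarrow> AE \<theta> in H. Mv t (\<kappa> \<theta>) = Rd \<theta> (u t)"
    using feas unfolding feasible_def by blast

  have u_T': "u t = u0 t" if t: "t \<in> T'" for t
  proof -
    have "t \<in> Sig" "t \<in> T" using t sub \<open>T' \<subseteq> T\<close> by auto
    have "tv_norm \<gamma> \<le> tv_norm (joint_Rj H lam0)"
      using solution feas0 by (auto simp: is_arg_min_def not_less)
    then have "tv_norm (u t) \<le> tv_norm (u0 t)"
      using tv_norm_feasible[OF feas \<open>t \<in> Sig\<close> H] tv_norm_feasible[OF feas0 \<open>t \<in> Sig\<close> H] by simp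
    moreover have "u t \<in> meas_pos \<Omega>" "Ob t (u t) = f0 t"
      using feas \<open>t \<in> Sig\<close> \<open>t \<in> T\<close> by (auto simp: feasible_def)
    \<comment> \<open>\<open>u t\<close> is admissible with norm at most that of the minimizer
      \<open>u0 t\<close>, hence is itself a minimizer.\<close>
    moreover have "is_arg_min tv_norm (\<lambda>w'. w' \<in> meas_pos \<Omega> \<and> Ob t w' = f0 t) (u0 t)"
      using unique[OF t] by simp
    ultimately have "is_arg_min tv_norm (\<lambda>w'. w' \<in> meas_pos \<Omega> \<and> Ob t w' = f0 t) (u t)"
      unfolding is_arg_min_def by (meson order.strict_trans2)
    then show ?thesis using unique[OF t] by simp
  qed

  have \<kappa>_eq: "AE \<theta> in H. \<kappa> \<theta> = Rj \<theta> lam0"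
    unfolding lam0
  proof (rule AE_slices_eq_Rj[OF generic sub(2) \<open>T' \<noteq> {}\<close> no_coincidence no_ghost])
    show "AE \<theta> in H. sets (\<kappa> \<theta>) = sets borel"
      using meas_posD(3)[OF H(1)] \<kappa> by (auto simp: disintegrates_def dest: meas_posD elim!: eventually_mono)
    show "AE \<theta> in H. Mv t (\<kappa> \<theta>) = particles N m (\<lambda>i. \<theta> \<bullet> (x i + t *\<^sub>R v i))" if "t \<in> T'" for t
      using Mv_\<kappa>[of t] sub that by (auto simp: u_T' u0_eq Rd_particles)
  qed

  \<comment> \<open>At times outside \<open>T'\<close> the information comes back from the slices:
    once they are known, the constraint yields the projections of \<open>u t\<close>.\<close>
  have "u t = u0 t" if "t \<in> Sig" for t
    unfolding u0_eq
  proof (rule eq_particles_if_AE_Rd_eq[OF generic H(2) meas_posD(1)[OF H(1)]])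
    show "finite_measure (u t)" "sets (u t) = sets borel"
      using feas that by (auto simp: feasible_def dest: meas_posD)
    show "AE \<theta> in H. Rd \<theta> (u t) = particles N m (\<lambda>i. \<theta> \<bullet> (x i + t *\<^sub>R v i))"
      using Mv_\<kappa>[OF that] \<kappa>_eq
    proof eventually_elim
      case (elim \<theta>)
      then have "Rd \<theta> (u t) = Mv t (Rj \<theta> lam0)" by simp
      also have "\<dots> = particles N m (\<lambda>i. \<theta> \<bullet> (x i + t *\<^sub>R v i))"
        by (simp add: lam0 Rj_particles Mv_particles inner_add_right)
      finally show ?case .
    qed
  qed
  \<comment> \<open>So far \<open>\<kappa>\<close> is the disintegration supplied by feasibility;
    uniqueness transfers the result to any other.\<close>
  moreover have "AE \<theta> in H. \<kappa>' \<theta> = Rj \<theta> lam0"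
    if "disintegrates \<Theta> H (Gam \<Omega> Sig \<Theta>) \<gamma> \<kappa>'" for \<kappa>'
  proof -
    have "finite_measure \<gamma>" using feas by (auto simp: feasible_def dest: meas_posD)
    from disintegrates_unique[OF that \<kappa> H(1) this] \<kappa>_eq
    show ?thesis by eventually_elim simp
  qed
  ultimately show ?thesis by blast
qed

end
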